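(* If $G$ is a connected perfect graph with $\alpha(G) \geq 4$, then $c(G) < \alpha(G)$.
   Context: All graphs are finite and simple. $\alpha(G)$ is the independence number of $G$. A graph $G$ is perfect if every induced subgraph $H$ of $G$ satisfies $\chi(H)=\omega(H)$ (chromatic number equals clique number). The Cops and Robbers game on $G$: first $m$ cops are placed on vertices (possibly sharing vertices), then the robber is placed on a vertex; players alternate turns starting with the cops; on a turn each cop (resp. the robber) moves to an adjacent vertex or stays. The cops win if after finitely many moves a cop occupies the robber's vertex; otherwise the robber wins. The cop number $c(G)$ is the least $m$ such that $m$ cops can always win. *)

theory Defs
  imports "Graph_Theory.Digraph_Component"
begin

text \<open>
  As in the imported library, a finite simple graph is a finite, loop-free, symmetric digraph
  without parallel arcs (locale \<^locale>\<open>graph\<close>); adjacency of u and v is \<open>u \<rightarrow>\<^bsub>G\<^esub> v\<close>.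
\<close>

definition independent_set :: "('a,'b) pre_digraph \<Rightarrow> 'a set \<Rightarrow> bool" where
  "independent_set G S \<longleftrightarrow> S \<subseteq> verts G \<and> (\<forall>u\<in>S. \<forall>v\<in>S. \<not> u \<rightarrow>\<^bsub>G\<^esub> v)"

definition independence_number :: "('a,'b) pre_digraph \<Rightarrow> nat" where
  "independence_number G = Max (card ` {S. independent_set G S})"

definition clique :: "('a,'b) pre_digraph \<Rightarrow> 'a set \<Rightarrow> bool" where
  "clique G S \<longleftrightarrow> S \<subseteq> verts G \<and> (\<forall>u\<in>S. \<forall>v\<in>S. u \<noteq> v \<longrightarrow> u \<rightarrow>\<^bsub>G\<^esub> v)"

definition clique_number :: "('a,'b) pre_digraph \<Rightarrow> nat" where
  "clique_number G = Max (card ` {S. clique G S})"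

definition proper_coloring :: "('a,'b) pre_digraph \<Rightarrow> nat \<Rightarrow> ('a \<Rightarrow> nat) \<Rightarrow> bool" where
  "proper_coloring G k f \<longleftrightarrow>
     (\<forall>v\<in>verts G. f v < k) \<and> (\<forall>u\<in>verts G. \<forall>v\<in>verts G. u \<rightarrow>\<^bsub>G\<^esub> v \<longrightarrow> f u \<noteq> f v)"

definition chromatic_number :: "('a,'b) pre_digraph \<Rightarrow> nat" where
  "chromatic_number G = (LEAST k. \<exists>f. proper_coloring G k f)"

definition perfect_graph :: "('a,'b) pre_digraph \<Rightarrow> bool" where
  "perfect_graph G \<longleftrightarrow> (\<forall>H. induced_subgraph H G \<longrightarrow> chromatic_number H = clique_number H)"

definition game_move :: "('a,'b) pre_digraph \<Rightarrow> 'a \<Rightarrow> 'a \<Rightarrow> bool" where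
  "game_move G u v \<longleftrightarrow> v = u \<or> u \<rightarrow>\<^bsub>G\<^esub> v"

definition robber_play :: "('a,'b) pre_digraph \<Rightarrow> (nat \<Rightarrow> 'a) \<Rightarrow> bool" where
  "robber_play G r \<longleftrightarrow> r 0 \<in> verts G \<and> (\<forall>n. game_move G (r n) (r (Suc n)))"

text \<open>
  A strategy of the cops maps the list of robber positions seen so far to the next positions of
  the cops: \<open>\<sigma> [] i\<close> is the initial vertex of cop i, and \<open>\<sigma> [r 0, \<dots>, r n] i\<close> is its vertex after
  the cops' answer to \<open>r n\<close>. (The cops' own past positions are determined by \<open>\<sigma>\<close>.)
\<close>

definition cop_position :: "('a list \<Rightarrow> nat \<Rightarrow> 'a) \<Rightarrow> (nat \<Rightarrow> 'a) \<Rightarrow> nat \<Rightarrow> nat \<Rightarrow> 'a" where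
  "cop_position \<sigma> r n = \<sigma> (map r [0..<n])"

definition cop_strategy :: "('a,'b) pre_digraph \<Rightarrow> nat \<Rightarrow> ('a list \<Rightarrow> nat \<Rightarrow> 'a) \<Rightarrow> bool" where
  "cop_strategy G m \<sigma> \<longleftrightarrow>
     (\<forall>i<m. \<sigma> [] i \<in> verts G) \<and>
     (\<forall>r. robber_play G r \<longrightarrow>
        (\<forall>n. \<forall>i<m. game_move G (cop_position \<sigma> r n i) (cop_position \<sigma> r (Suc n) i)))"

text \<open>
  The game runs through \<open>c 0, r 0, c 1, r 1, \<dots>\<close> with \<open>c = cop_position \<sigma> r\<close>. The first disjunct is
  the robber being placed on, or moving to, a vertex of a cop; the second is a cop moving to the
  vertex of the robber. Moves after the first capture are irrelevant.
\<close>

definition captures :: "nat \<Rightarrow> ('a list \<Rightarrow> nat \<Rightarrow> 'a) \<Rightarrow> (nat \<Rightarrow> 'a) \<Rightarrow> bool" where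
  "captures m \<sigma> r \<longleftrightarrow>
     (\<exists>n. \<exists>i<m. cop_position \<sigma> r n i = r n \<or> cop_position \<sigma> r (Suc n) i = r n)"

definition cops_can_win :: "('a,'b) pre_digraph \<Rightarrow> nat \<Rightarrow> bool" where
  "cops_can_win G m \<longleftrightarrow>
     (\<exists>\<sigma>. cop_strategy G m \<sigma> \<and> (\<forall>r. robber_play G r \<longrightarrow> captures m \<sigma> r))"

definition cop_number :: "('a,'b) pre_digraph \<Rightarrow> nat" where
  "cop_number G = (LEAST m. cops_can_win G m)"

end

theory Submission
  imports Defs
begin

text \<open>
  By Lovasz's theorem a perfect graph with independence number \<open>k\<close> is covered by \<open>k\<close> cliques. With one
  cop in each clique but one, the robber is confined to the remaining clique \<open>d\<close>. If no edge joins
  \<open>d\<close> to some clique \<open>b\<close>, cop \<open>b\<close> is not needed as a guard and can walk to \<open>d\<close>. Otherwise all pairs of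
  cliques are joined by edges, and a few moves suffice: if there are edges \<open>y p\<close>, \<open>p y'\<close>, \<open>y' z\<close> with
  ends in four different cliques, two cops placed on \<open>y\<close> and \<open>y'\<close> leave the robber only escapes that
  create an induced 5-cycle; if there are no such edges, the robber is soon driven to a vertex with
  neighbours in too few cliques.
\<close>

section \<open>Perfect graphs\<close>

context graph
begin

lemma adj_sym: "u \<rightarrow>\<^bsub>G\<^esub> v \<Longrightarrow> v \<rightarrow>\<^bsub>G\<^esub> u"
  by (rule graph_symmetric)

lemma adj_induce_iff:
  "u \<rightarrow>\<^bsub>G \<restriction> S\<^esub> v \<longleftrightarrow> u \<rightarrow>\<^bsub>G\<^esub> v \<and> u \<in> S \<and> v \<in> S"
  by (auto simp: arcs_ends_conv)

lemma finite_clique: "clique G K \<Longrightarrow> finite K"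
  by (auto simp: clique_def intro: finite_subset[OF _ finite_verts])

lemma clique_induce_iff:
  assumes "S \<subseteq> verts G"
  shows "clique (G \<restriction> S) K \<longleftrightarrow> clique G K \<and> K \<subseteq> S"
  using assms by (auto simp: clique_def adj_induce_iff)

text \<open>Perfection enters all later arguments in this form. A bound on clique sizes is enough,
  as a colouring with fewer than \<open>n\<close> colours also qualifies.\<close>

lemma perfect_colouring:
  assumes perfect: "perfect_graph G" and S: "S \<subseteq> verts G"
    and bound: "\<And>K. clique G K \<Longrightarrow> K \<subseteq> S \<Longrightarrow> card K \<le> n"
  shows "\<exists>f. (\<forall>v\<in>S. f v < n) \<and> (\<forall>u\<in>S. \<forall>v\<in>S. u \<rightarrow>\<^bsub>G\<^esub> v \<longrightarrow> f u \<noteq> f v)"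
proof -
  have fin: "finite S" using S finite_verts finite_subset by blast
  \<comment> \<open>An injective numbering is a proper colouring, so the \<open>LEAST\<close> in
    \<open>chromatic_number\<close> is attained.\<close>
  obtain g :: "'a \<Rightarrow> nat" where g: "inj_on g S" "g ` S = {..<card S}"
    using ex_bij_betw_finite_nat[OF fin] by (auto simp: bij_betw_def atLeast0LessThan)
  then have "proper_coloring (G \<restriction> S) (card S) g"
    unfolding proper_coloring_def adj_induce_iff
    by (auto simp: inj_on_def dest: adj_not_same)
  then have "\<exists>f. proper_coloring (G \<restriction> S) (chromatic_number (G \<restriction> S)) f"
    unfolding chromatic_number_def
    using LeastI_ex[of "\<lambda>m. \<exists>f. proper_coloring (G \<restriction> S) m f"] by blast
  then obtain f where f: "proper_coloring (G \<restriction> S) (chromatic_number (G \<restriction> S)) f" ..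
  have eq: "{K. clique (G \<restriction> S) K} = {K. clique G K \<and> K \<subseteq> S}"
    using clique_induce_iff[OF S] by blast
  have "finite {K. clique G K \<and> K \<subseteq> S}"
    by (rule finite_subset[of _ "Pow S"]) (auto simp: fin)
  moreover have "{} \<in> {K. clique G K \<and> K \<subseteq> S}" by (simp add: clique_def)
  ultimately have "clique_number (G \<restriction> S) \<le> n"
    unfolding clique_number_def eq using bound by (subst Max_le_iff) auto
  moreover have "chromatic_number (G \<restriction> S) = clique_number (G \<restriction> S)"
    using perfect induced_induce[OF S] by (simp add: perfect_graph_def)
  ultimately have "chromatic_number (G \<restriction> S) \<le> n" by simp
  then have "(\<forall>v\<in>S. f v < n) \<and> (\<forall>u\<in>S. \<forall>v\<in>S. u \<rightarrow>\<^bsub>G\<^esub> v \<longrightarrow> f u \<noteq> f v)"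
    using f less_le_trans unfolding proper_coloring_def adj_induce_iff induce_subgraph_verts by blast
  then show ?thesis by blast
qed

text \<open>This encodes a proper colouring of the graph in which each \<open>v\<close> is replaced
  by a clique of \<open>w v\<close> copies; weight 0 deletes \<open>v\<close>. The colours of the
  copies form \<open>F v\<close>.\<close>

definition weighted_colouring :: "('a \<Rightarrow> nat) \<Rightarrow> nat \<Rightarrow> ('a \<Rightarrow> nat set) \<Rightarrow> bool" where
  "weighted_colouring w n F \<longleftrightarrow>
     (\<forall>v\<in>verts G. F v \<subseteq> {..<n} \<and> card (F v) = w v) \<and>
     (\<forall>u\<in>verts G. \<forall>v\<in>verts G. u \<rightarrow>\<^bsub>G\<^esub> v \<longrightarrow> F u \<inter> F v = {})"

text \<open>
  This is Lovasz's replication lemma. If \<open>w v \<ge> 2\<close>, colour \<open>w\<close> lowered by one at \<open>v\<close>, and let \<open>A\<close> be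
  the class of a colour used at \<open>v\<close>. Removing \<open>A\<close> from \<open>w\<close> lowers the weight of every maximum
  clique, so the remaining weights need only \<open>n - 1\<close> colours and \<open>A\<close> itself is the last one.
\<close>

lemma perfect_weighted_colouring:
  assumes perfect: "perfect_graph G"
    and "\<And>K. clique G K \<Longrightarrow> sum w K \<le> n"
  shows "\<exists>F. weighted_colouring w n F"
  using assms(2)
proof (induction "sum w (verts G)" arbitrary: w n rule: less_induct)
  case less
  show ?case
  proof (cases "\<exists>v\<in>verts G. w v \<ge> 2")
    case False
    define S where "S = {v \<in> verts G. w v = 1}"
    have w01: "w v = (if v \<in> S then 1 else 0)" if "v \<in> verts G" for v
    proof -
      have "w v < 2" using False that by (meson not_less)
      then show ?thesis using that by (auto simp: S_def)
    qed
    have "card K \<le> n" if "clique G K" "K \<subseteq> S" for K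
    proof -
      have "sum w K = (\<Sum>v\<in>K. 1)"
        by (rule sum.cong) (use that in \<open>auto simp: S_def\<close>)
      then show ?thesis using less.prems[OF that(1)] by simp
    qed
    then obtain f where f: "\<forall>v\<in>S. f v < n" "\<forall>u\<in>S. \<forall>v\<in>S. u \<rightarrow>\<^bsub>G\<^esub> v \<longrightarrow> f u \<noteq> f v"
      using perfect_colouring[OF perfect, of S n] by (auto simp: S_def)
    have "weighted_colouring w n (\<lambda>v. if v \<in> S then {f v} else {})"
      unfolding weighted_colouring_def using f w01 by auto
    then show ?thesis by blast
  next
    case True
    then obtain v where v: "v \<in> verts G" "w v \<ge> 2" by blast
    define w1 where "w1 = w(v := w v - 1)"
    have w1_le: "w1 u \<le> w u" for u by (simp add: w1_def)
    have w1_v: "w v = Suc (w1 v)" "w1 v \<ge> 1" using v(2) by (auto simp: w1_def)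
    have "sum w1 (verts G) < sum w (verts G)"
      by (rule sum_strict_mono_ex1) (use v w1_le w1_v in \<open>auto intro!: bexI[of _ v]\<close>)
    moreover have "sum w1 K \<le> n" if "clique G K" for K
      using less.prems[OF that] sum_mono[of K w1 w] w1_le by (meson le_trans)
    ultimately obtain F where F: "weighted_colouring w1 n F"
      using less.hyps by blast
    have F_sub: "F u \<subseteq> {..<n}" and F_card: "card (F u) = w1 u" if "u \<in> verts G" for u
      using F that by (auto simp: weighted_colouring_def)
    have F_disj: "F u \<inter> F u' = {}" if "u \<rightarrow>\<^bsub>G\<^esub> u'" for u u'
      using F that adj_in_verts[OF that] by (auto simp: weighted_colouring_def)
    have F_fin: "finite (F u)" if "u \<in> verts G" for u
      using F_sub[OF that] finite_subset by blast
    obtain c where c: "c \<in> F v" using F_card[OF v(1)] w1_v(2) by fastforce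
    then have n: "c < n" "n \<ge> 1" using F_sub[OF v(1)] by auto
    define A where "A = {u \<in> verts G. c \<in> F u}"
    \<comment> \<open>At \<open>v\<close> the weight has already dropped in \<open>w1\<close>;
      excluding \<open>v\<close> makes \<open>w2\<close> equal to \<open>w\<close> minus the
      indicator of \<open>A\<close> on the vertices.\<close>
    define w2 where "w2 u = (if u \<in> A - {v} then w1 u - 1 else w1 u)" for u
    have w1_A: "w1 u \<ge> 1" if "u \<in> A" for u
    proof -
      have u: "u \<in> verts G" and "F u \<noteq> {}" using that by (auto simp: A_def)
      then have "card (F u) \<noteq> 0" using F_fin[OF u] by simp
      then show ?thesis using F_card[OF u] by simp
    qed
    have w_w2: "w u = (if u \<in> A then Suc (w2 u) else w2 u)" if "u \<in> verts G" for u
    proof (cases "u = v")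
      case True
      then show ?thesis using c v(1) w1_v(1) by (simp add: w2_def A_def)
    next
      case False
      then have "w1 u = w u" by (simp add: w1_def)
      then show ?thesis using False w1_A[of u] by (cases "u \<in> A") (simp_all add: w2_def)
    qed
    have w2_le: "w2 u \<le> w1 u" for u by (simp add: w2_def)
    have w2_le_w: "w2 u \<le> w u" for u using w1_le w2_le le_trans by blast
    have w2_less: "w2 v < w v" using w1_v(1) w2_le[of v] by linarith
    have "sum w2 (verts G) < sum w (verts G)"
      by (rule sum_strict_mono_ex1) (use v w2_le_w w2_less in auto)
    moreover have "sum w2 K \<le> n - 1" if K: "clique G K" for K
    proof -
      have KV: "K \<subseteq> verts G" and finK: "finite K"
        using K finite_clique by (auto simp: clique_def)
      \<comment> \<open>A clique through \<open>v\<close> or another vertex of \<open>A\<close>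
        loses weight there. One avoiding \<open>A\<close> has disjoint colour sets under
        \<open>F\<close>, all without \<open>c\<close>.\<close>
      consider "v \<in> K" | u where "v \<notin> K" "u \<in> K" "u \<in> A" | "K \<inter> A = {}" by blast
      then show ?thesis
      proof cases
        case 1
        have "sum w2 K < sum w K"
          by (rule sum_strict_mono_ex1[OF finK]) (use 1 w2_le_w w2_less in auto)
        then show ?thesis using less.prems[OF K] by linarith
      next
        case 2
        have "sum w2 K < sum w K"
        proof (rule sum_strict_mono_ex1[OF finK])
          show "\<forall>u\<in>K. w2 u \<le> w u" using w2_le_w by blast
          have "w2 u < w u" using w_w2[of u] 2 KV by auto
          then show "\<exists>u\<in>K. w2 u < w u" using 2 by blast
        qed
        then show ?thesis using less.prems[OF K] by linarith
      next
        case 3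
        have "sum w2 K \<le> sum w1 K" by (rule sum_mono) (rule w2_le)
        also have "\<dots> = (\<Sum>u\<in>K. card (F u))"
          by (rule sum.cong) (use F_card KV in auto)
        also have "\<dots> = card (\<Union>u\<in>K. F u)"
        proof (rule card_UN_disjoint[symmetric, OF finK])
          show "\<forall>u\<in>K. finite (F u)" using F_fin KV by blast
          show "\<forall>u\<in>K. \<forall>u'\<in>K. u \<noteq> u' \<longrightarrow> F u \<inter> F u' = {}"
            using K F_disj by (auto simp: clique_def)
        qed
        also have "\<dots> \<le> card ({..<n} - {c})"
          by (rule card_mono) (use 3 KV F_sub in \<open>auto simp: A_def\<close>)
        also have "\<dots> = n - 1" using n by simp
        finally show ?thesis .
      qed
    qed
    ultimately obtain F2 where F2: "weighted_colouring w2 (n - 1) F2"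
      using less.hyps by blast
    define F' where "F' u = (if u \<in> A then insert (n - 1) (F2 u) else F2 u)" for u
    have F2_sub: "F2 u \<subseteq> {..<n - 1}" and F2_card: "card (F2 u) = w2 u" if "u \<in> verts G" for u
      using F2 that by (auto simp: weighted_colouring_def)
    have F2_fin: "finite (F2 u)" if "u \<in> verts G" for u
      using F2_sub[OF that] finite_subset by blast
    have "F' u \<subseteq> {..<n} \<and> card (F' u) = w u" if u: "u \<in> verts G" for u
    proof -
      have "n - 1 \<notin> F2 u" using F2_sub[OF u] by auto
      then have "card (F' u) = w u"
        using w_w2[OF u] F2_card[OF u] F2_fin[OF u] by (simp add: F'_def)
      moreover have "F' u \<subseteq> {..<n}" using F2_sub[OF u] n(2) by (auto simp: F'_def)
      ultimately show ?thesis by blast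
    qed
    moreover have "F' u \<inter> F' u' = {}" if uu: "u \<in> verts G" "u' \<in> verts G" "u \<rightarrow>\<^bsub>G\<^esub> u'" for u u'
    proof -
      have "u \<notin> A \<or> u' \<notin> A" using F_disj[OF uu(3)] by (auto simp: A_def)
      moreover have "F2 u \<inter> F2 u' = {}" using F2 uu by (simp add: weighted_colouring_def)
      moreover have "n - 1 \<notin> F2 u" "n - 1 \<notin> F2 u'" using F2_sub uu by auto
      ultimately show ?thesis by (auto simp: F'_def)
    qed
    ultimately have "weighted_colouring w n F'" by (simp add: weighted_colouring_def)
    then show ?thesis by blast
  qed
qed

text \<open>
  Otherwise every clique \<open>K\<close> is missed by a maximum independent set \<open>A K\<close>. Weighting each vertex by
  the number of sets \<open>A K\<close> containing it, every clique weighs less than the number \<open>m\<close> of cliques,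
  so \<open>m - 1\<close> independent sets would cover the total weight \<open>m * a\<close>.
\<close>

lemma perfect_clique_meeting_independent_sets:
  assumes perfect: "perfect_graph G" and S: "S \<subseteq> verts G"
    and a: "a > 0" "\<And>A. independent_set G A \<Longrightarrow> A \<subseteq> S \<Longrightarrow> card A \<le> a"
  shows "\<exists>K. clique G K \<and> K \<subseteq> S \<and>
    (\<forall>A. independent_set G A \<longrightarrow> A \<subseteq> S \<longrightarrow> card A = a \<longrightarrow> K \<inter> A \<noteq> {})"
proof (rule ccontr)
  assume neg: "\<not> ?thesis"
  define C where "C = {K. clique G K \<and> K \<subseteq> S}"
  have finS: "finite S" using S finite_verts finite_subset by blast
  have finC: "finite C" by (rule finite_subset[of _ "Pow S"]) (auto simp: C_def finS)
  \<comment> \<open>The empty clique keeps \<open>C\<close> nonempty, so \<open>card C - 1\<close>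
    is really smaller than \<open>card C\<close>.\<close>
  have "{} \<in> C" by (simp add: C_def clique_def)
  then have m: "card C \<ge> 1" using finC by (auto simp: Suc_le_eq card_gt_0_iff)
  have "\<forall>K\<in>C. \<exists>A. independent_set G A \<and> A \<subseteq> S \<and> card A = a \<and> K \<inter> A = {}"
    using neg by (auto simp: C_def)
  then obtain A where A: "\<And>K. K \<in> C \<Longrightarrow> independent_set G (A K) \<and> A K \<subseteq> S \<and> card (A K) = a \<and> K \<inter> A K = {}"
    by metis
  define w where "w v = card {K \<in> C. v \<in> A K}" for v
  have sum_w: "sum w T = (\<Sum>K\<in>C. card (T \<inter> A K))" if "finite T" for T
  proof -
    have "sum w T = (\<Sum>v\<in>T. \<Sum>K\<in>C. if v \<in> A K then 1 else 0)"
      unfolding w_def using finC by (simp add: sum.If_cases Int_def)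
    also have "\<dots> = (\<Sum>K\<in>C. \<Sum>v\<in>T. if v \<in> A K then 1 else 0)" by (rule sum.swap)
    also have "\<dots> = (\<Sum>K\<in>C. card (T \<inter> A K))"
      using that by (simp add: sum.If_cases Int_def)
    finally show ?thesis .
  qed
  have "sum w K \<le> card C - 1" if K: "clique G K" for K
  proof -
    have finK: "finite K" using K by (rule finite_clique)
    have le1: "card (K \<inter> A L) \<le> 1" if "L \<in> C" for L
    proof -
      have "x = y" if "x \<in> K \<inter> A L" "y \<in> K \<inter> A L" for x y
        using A[OF \<open>L \<in> C\<close>] K that unfolding clique_def independent_set_def by blast
      then show ?thesis using finK by (simp add: card_le_Suc0_iff_eq)
    qed
    \<comment> \<open>\<open>K\<close> may leave \<open>S\<close>, but
      \<open>A (K \<inter> S)\<close> lies in \<open>S\<close> and so misses all of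
      \<open>K\<close>. Every other term contributes at most 1.\<close>
    have KS: "K \<inter> S \<in> C" using K by (auto simp: C_def clique_def)
    have "sum w K = (\<Sum>L\<in>C - {K \<inter> S}. card (K \<inter> A L)) + card (K \<inter> A (K \<inter> S))"
      using sum_w[OF finK] sum.remove[OF finC KS] by (simp add: add.commute)
    also have "K \<inter> A (K \<inter> S) = {}" using A[OF KS] by blast
    also have "(\<Sum>L\<in>C - {K \<inter> S}. card (K \<inter> A L)) \<le> (\<Sum>L\<in>C - {K \<inter> S}. 1)"
      by (rule sum_mono) (use le1 in auto)
    also have "\<dots> = card C - 1" using KS finC by simp
    finally show ?thesis by simp
  qed
  then obtain F where F: "weighted_colouring w (card C - 1) F"
    using perfect_weighted_colouring[OF perfect] by blast
  \<comment> \<open>The total weight is counted twice: each set \<open>A K\<close> contributes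
    exactly \<open>a\<close>, each of the \<open>card C - 1\<close> colour classes is independent
    and contributes at most \<open>a\<close>.\<close>
  have "card C * a = (\<Sum>K\<in>C. card (S \<inter> A K))"
    using A by (simp add: Int_absorb1)
  also have "\<dots> = sum w S" using sum_w[OF finS] by simp
  also have "\<dots> = (\<Sum>v\<in>S. \<Sum>i<card C - 1. if i \<in> F v then 1 else 0)"
  proof (rule sum.cong[OF refl])
    fix v assume "v \<in> S"
    then have "F v \<subseteq> {..<card C - 1}" "card (F v) = w v"
      using F S by (auto simp: weighted_colouring_def)
    then show "w v = (\<Sum>i<card C - 1. if i \<in> F v then 1 else 0)"
      by (simp add: sum.If_cases Int_absorb1)
  qed
  also have "\<dots> = (\<Sum>i<card C - 1. \<Sum>v\<in>S. if i \<in> F v then 1 else 0)" by (rule sum.swap)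
  also have "\<dots> = (\<Sum>i<card C - 1. card {v \<in> S. i \<in> F v})"
    using finS by (simp add: sum.If_cases Int_def)
  also have "\<dots> \<le> (\<Sum>i<card C - 1. a)"
  proof (rule sum_mono)
    fix i
    have "independent_set G {v \<in> S. i \<in> F v}"
      using F S by (fastforce simp: independent_set_def weighted_colouring_def)
    then show "card {v \<in> S. i \<in> F v} \<le> a" using a(2) by blast
  qed
  also have "\<dots> = (card C - 1) * a" by simp
  finally have "card C \<le> card C - 1" using a(1) by simp
  then show False using m by linarith
qed

text \<open>This is Lovasz's theorem in the form of clique covers. Removing a clique that meets all
  independent sets of size \<open>Suc a\<close> lowers the bound by one; that clique gets the new
  label \<open>a\<close>.\<close>

lemma perfect_clique_cover:
  assumes perfect: "perfect_graph G" and "S \<subseteq> verts G"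
    and "\<And>A. independent_set G A \<Longrightarrow> A \<subseteq> S \<Longrightarrow> card A \<le> a"
  shows "\<exists>f. (\<forall>v\<in>S. f v < a) \<and> (\<forall>u\<in>S. \<forall>v\<in>S. f u = f v \<longrightarrow> u \<noteq> v \<longrightarrow> u \<rightarrow>\<^bsub>G\<^esub> v)"
  using assms(2,3)
proof (induction a arbitrary: S)
  case 0
  have "S = {}"
  proof (rule ccontr)
    assume "S \<noteq> {}"
    then obtain v where "v \<in> S" by blast
    then have "independent_set G {v}"
      using 0 adj_not_same by (auto simp: independent_set_def)
    then show False using 0(2)[of "{v}"] \<open>v \<in> S\<close> by simp
  qed
  then show ?case by simp
next
  case (Suc a)
  obtain K where K: "clique G K" "K \<subseteq> S"
    "\<And>A. independent_set G A \<Longrightarrow> A \<subseteq> S \<Longrightarrow> card A = Suc a \<Longrightarrow> K \<inter> A \<noteq> {}"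
    using perfect_clique_meeting_independent_sets[OF perfect Suc.prems(1) _ Suc.prems(2)] by blast
  have "card A \<le> a" if "independent_set G A" "A \<subseteq> S - K" for A
    using Suc.prems(2)[of A] K(3)[of A] that by (fastforce simp: le_Suc_eq)
  then obtain f where f: "\<forall>v\<in>S - K. f v < a"
    "\<forall>u\<in>S - K. \<forall>v\<in>S - K. f u = f v \<longrightarrow> u \<noteq> v \<longrightarrow> u \<rightarrow>\<^bsub>G\<^esub> v"
    using Suc.IH[of "S - K"] Suc.prems(1) by blast
  define f' where "f' v = (if v \<in> K then a else f v)" for v
  have "\<forall>v\<in>S. f' v < Suc a" using f(1) by (auto simp: f'_def less_Suc_eq)
  moreover have "\<forall>u\<in>S. \<forall>v\<in>S. f' u = f' v \<longrightarrow> u \<noteq> v \<longrightarrow> u \<rightarrow>\<^bsub>G\<^esub> v"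
    using f K(1) by (auto simp: f'_def clique_def)
  ultimately show ?case by blast
qed

text \<open>A chordless 5-cycle has no triangle, yet as an odd cycle it cannot be coloured with two
  colours.\<close>

lemma perfect_no_induced_C5:
  assumes perfect: "perfect_graph G"
    and edges: "v\<^sub>1 \<rightarrow>\<^bsub>G\<^esub> v\<^sub>2" "v\<^sub>2 \<rightarrow>\<^bsub>G\<^esub> v\<^sub>3" "v\<^sub>3 \<rightarrow>\<^bsub>G\<^esub> v\<^sub>4" "v\<^sub>4 \<rightarrow>\<^bsub>G\<^esub> v\<^sub>5" "v\<^sub>5 \<rightarrow>\<^bsub>G\<^esub> v\<^sub>1"
    and non_edges: "\<not> v\<^sub>1 \<rightarrow>\<^bsub>G\<^esub> v\<^sub>3" "\<not> v\<^sub>2 \<rightarrow>\<^bsub>G\<^esub> v\<^sub>4" "\<not> v\<^sub>3 \<rightarrow>\<^bsub>G\<^esub> v\<^sub>5" "\<not> v\<^sub>4 \<rightarrow>\<^bsub>G\<^esub> v\<^sub>1" "\<not> v\<^sub>5 \<rightarrow>\<^bsub>G\<^esub> v\<^sub>2"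
  shows False
proof -
  define S where "S = {v\<^sub>1, v\<^sub>2, v\<^sub>3, v\<^sub>4, v\<^sub>5}"
  have S: "S \<subseteq> verts G" using edges adj_in_verts by (auto simp: S_def)
  have distinct: "v\<^sub>1 \<noteq> v\<^sub>3" "v\<^sub>2 \<noteq> v\<^sub>4" "v\<^sub>3 \<noteq> v\<^sub>5" "v\<^sub>4 \<noteq> v\<^sub>1" "v\<^sub>5 \<noteq> v\<^sub>2"
    using edges non_edges adj_sym by blast+
  have "card K \<le> 2" if K: "clique G K" "K \<subseteq> S" for K
  proof -
    have *: "\<not> (v\<^sub>1 \<in> K \<and> v\<^sub>3 \<in> K)" "\<not> (v\<^sub>2 \<in> K \<and> v\<^sub>4 \<in> K)" "\<not> (v\<^sub>3 \<in> K \<and> v\<^sub>5 \<in> K)"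
      "\<not> (v\<^sub>4 \<in> K \<and> v\<^sub>1 \<in> K)" "\<not> (v\<^sub>5 \<in> K \<and> v\<^sub>2 \<in> K)"
      using K(1) non_edges distinct by (auto simp: clique_def)
    have "K \<subseteq> {v\<^sub>1, v\<^sub>2} \<or> K \<subseteq> {v\<^sub>2, v\<^sub>3} \<or> K \<subseteq> {v\<^sub>3, v\<^sub>4} \<or> K \<subseteq> {v\<^sub>4, v\<^sub>5} \<or> K \<subseteq> {v\<^sub>5, v\<^sub>1}"
      using * K(2) unfolding S_def by blast
    then obtain x y where "K \<subseteq> {x, y}" by blast
    then have "card K \<le> card {x, y}" by (intro card_mono) auto
    also have "\<dots> \<le> 2" by (simp add: card_insert_if)
    finally show ?thesis .
  qed
  then obtain f where f: "\<forall>v\<in>S. f v < (2::nat)" "\<forall>u\<in>S. \<forall>v\<in>S. u \<rightarrow>\<^bsub>G\<^esub> v \<longrightarrow> f u \<noteq> f v"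
    using perfect_colouring[OF perfect S] by blast
  have "f v\<^sub>1 \<noteq> f v\<^sub>2" "f v\<^sub>2 \<noteq> f v\<^sub>3" "f v\<^sub>3 \<noteq> f v\<^sub>4" "f v\<^sub>4 \<noteq> f v\<^sub>5" "f v\<^sub>5 \<noteq> f v\<^sub>1"
    using f(2) edges by (auto simp: S_def)
  moreover have "f v\<^sub>1 < 2" "f v\<^sub>2 < 2" "f v\<^sub>3 < 2" "f v\<^sub>4 < 2" "f v\<^sub>5 < 2"
    using f(1) by (auto simp: S_def)
  ultimately show False by linarith
qed

end

section \<open>Winning positions\<close>

text \<open>
  It is the cops' turn in the position \<open>cop_win G I c r\<close>.
\<close>

inductive cop_win :: "('a,'b) pre_digraph \<Rightarrow> 'i set \<Rightarrow> ('i \<Rightarrow> 'a) \<Rightarrow> 'a \<Rightarrow> bool" for G I where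
  capture: "i \<in> I \<Longrightarrow> game_move G (c i) r \<Longrightarrow> cop_win G I c r"
| move: "(\<And>i. i \<in> I \<Longrightarrow> game_move G (c i) (c' i)) \<Longrightarrow>
    (\<And>r'. game_move G r r' \<Longrightarrow> cop_win G I c' r') \<Longrightarrow> cop_win G I c r"

section \<open>From winning positions to strategies\<close>

lemma robber_play_Suc:
  assumes "wf_digraph G" "robber_play G \<rho>"
  shows "robber_play G (\<lambda>n. \<rho> (Suc n))"
proof -
  have "game_move G (\<rho> 0) (\<rho> (Suc 0))" "\<rho> 0 \<in> verts G"
    using assms(2) by (auto simp: robber_play_def)
  then have "\<rho> (Suc 0) \<in> verts G"
    using wf_digraph.adj_in_verts(2)[OF assms(1)] by (auto simp: game_move_def)
  then show ?thesis using assms(2) by (simp add: robber_play_def)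
qed

text \<open>The endgames name cops after cliques, whereas \<open>cops_can_win\<close> numbers them.
  Cops with the same image under \<open>h\<close> simply move together.\<close>

lemma cop_win_reindex:
  assumes "cop_win G I c r" "h ` J = I"
  shows "cop_win G J (c \<circ> h) r"
  using assms
proof (induction rule: cop_win.induct)
  case (capture i c r)
  then show ?case by (auto intro!: cop_win.capture)
next
  case (move c c' r)
  show ?case
    by (rule cop_win.move[of _ _ _ "c' \<circ> h"]) (use move in \<open>auto simp: comp_def\<close>)
qed

text \<open>Legality of all cop moves and capture are stated together for one robber start, so that
  strategies for different starts can be glued.\<close>

definition wins_from :: "('a,'b) pre_digraph \<Rightarrow> nat \<Rightarrow> ('a list \<Rightarrow> nat \<Rightarrow> 'a) \<Rightarrow> 'a \<Rightarrow> bool" where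
  "wins_from G m \<sigma> r \<longleftrightarrow> (\<forall>\<rho>. robber_play G \<rho> \<longrightarrow> \<rho> 0 = r \<longrightarrow>
     (\<forall>n. \<forall>i<m. game_move G (cop_position \<sigma> \<rho> n i) (cop_position \<sigma> \<rho> (Suc n) i)) \<and> captures m \<sigma> \<rho>)"

lemma cop_position_Suc:
  "cop_position \<sigma> \<rho> (Suc n) = cop_position (\<lambda>xs. \<sigma> (\<rho> 0 # xs)) (\<lambda>n. \<rho> (Suc n)) n"
  unfolding cop_position_def by (simp add: map_upt_Suc del: upt_Suc)

lemma cop_win_strategy:
  assumes wf: "wf_digraph G" and "cop_win G {..<m} c r"
  shows "\<exists>\<sigma>. \<sigma> [] = c \<and> wins_from G m \<sigma> r"
  using assms(2)
proof (induction rule: cop_win.induct)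
  case (capture i c r)
  \<comment> \<open>The capturing cop moves to \<open>r\<close> and all cops then stand still;
    legality is demanded even after the capture.\<close>
  define \<sigma> where "\<sigma> xs = (if xs = [] then c else c(i := r))" for xs :: "'a list"
  have "game_move G (cop_position \<sigma> \<rho> n j) (cop_position \<sigma> \<rho> (Suc n) j)" for \<rho> n j
    using capture(2) by (auto simp: cop_position_def \<sigma>_def game_move_def)
  moreover have "captures m \<sigma> \<rho>" if "\<rho> 0 = r" for \<rho>
    unfolding captures_def using capture(1) that
    by (intro exI[of _ 0] exI[of _ i]) (auto simp: cop_position_def \<sigma>_def)
  ultimately have "wins_from G m \<sigma> r" by (simp add: wins_from_def)
  moreover have "\<sigma> [] = c" by (simp add: \<sigma>_def)
  ultimately show ?case by blast
next
  case (move c c' r)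
  have "\<forall>r'. \<exists>\<sigma>. game_move G r r' \<longrightarrow> \<sigma> [] = c' \<and> wins_from G m \<sigma> r'"
    using move.IH by blast
  then obtain \<tau> where \<tau>: "\<And>r'. game_move G r r' \<Longrightarrow> \<tau> r' [] = c'"
    "\<And>r'. game_move G r r' \<Longrightarrow> wins_from G m (\<tau> r') r'"
    by metis
  \<comment> \<open>The first answer \<open>c'\<close> is also the opening of
    \<open>\<tau> y\<close> for every legal reply \<open>y\<close>. From the second robber position
    \<open>y\<close> on, the list without its head is handed to \<open>\<tau> y\<close>.\<close>
  define \<sigma> where "\<sigma> xs = (case xs of [] \<Rightarrow> c | [x] \<Rightarrow> c' | x # y # ys \<Rightarrow> \<tau> y (y # ys))"
    for xs :: "'a list"
  have "wins_from G m \<sigma> r"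
    unfolding wins_from_def
  proof (intro allI impI)
    fix \<rho> assume \<rho>: "robber_play G \<rho>" "\<rho> 0 = r"
    let ?\<rho> = "\<lambda>n. \<rho> (Suc n)" and ?\<tau> = "\<tau> (\<rho> (Suc 0))"
    have gm: "game_move G r (\<rho> (Suc 0))" using \<rho> by (auto simp: robber_play_def)
    have pos: "cop_position \<sigma> \<rho> (Suc n) = cop_position ?\<tau> ?\<rho> n" for n
    proof (cases n)
      case 0
      then show ?thesis using \<tau>(1)[OF gm] by (simp add: cop_position_def \<sigma>_def)
    next
      case (Suc n')
      then show ?thesis by (simp add: cop_position_Suc cop_position_def \<sigma>_def map_upt_Suc del: upt_Suc)
    qed
    have w: "\<forall>n. \<forall>i<m. game_move G (cop_position ?\<tau> ?\<rho> n i) (cop_position ?\<tau> ?\<rho> (Suc n) i)"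
      "captures m ?\<tau> ?\<rho>"
      using \<tau>(2)[OF gm] robber_play_Suc[OF wf \<rho>(1)] by (auto simp: wins_from_def)
    have "game_move G (cop_position \<sigma> \<rho> n i) (cop_position \<sigma> \<rho> (Suc n) i)" if "i < m" for n i
    proof (cases n)
      case 0
      then show ?thesis using move.hyps(1)[of i] that by (simp add: cop_position_def \<sigma>_def)
    next
      case (Suc n')
      then show ?thesis using w(1) that by (simp add: pos)
    qed
    moreover obtain n i where "i < m"
      "cop_position ?\<tau> ?\<rho> n i = ?\<rho> n \<or> cop_position ?\<tau> ?\<rho> (Suc n) i = ?\<rho> n"
      using w(2) by (auto simp: captures_def)
    then have "captures m \<sigma> \<rho>"
      unfolding captures_def by (intro exI[of _ "Suc n"] exI[of _ i]) (simp add: pos)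
    ultimately show "(\<forall>n. \<forall>i<m. game_move G (cop_position \<sigma> \<rho> n i) (cop_position \<sigma> \<rho> (Suc n) i)) \<and>
        captures m \<sigma> \<rho>" by blast
  qed
  moreover have "\<sigma> [] = c" by (simp add: \<sigma>_def)
  ultimately show ?case by blast
qed

text \<open>The placement \<open>c\<close> must not depend on \<open>r\<close>, as the robber is
  placed second; his start then selects the strategy.\<close>

lemma cops_can_winI:
  assumes wf: "wf_digraph G" and I: "finite I" "card I = m"
    and c: "\<And>i. i \<in> I \<Longrightarrow> c i \<in> verts G"
    and win: "\<And>r. r \<in> verts G \<Longrightarrow> cop_win G I c r"
  shows "cops_can_win G m"
proof -
  obtain h where h: "h ` {..<m} = I"
    using ex_bij_betw_nat_finite[OF I(1)] I(2) by (auto simp: bij_betw_def atLeast0LessThan)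
  have "\<forall>r. \<exists>\<sigma>. r \<in> verts G \<longrightarrow> \<sigma> [] = c \<circ> h \<and> wins_from G m \<sigma> r"
    using cop_win_strategy[OF wf cop_win_reindex[OF win h]] by blast
  then obtain \<tau> where \<tau>: "\<And>r. r \<in> verts G \<Longrightarrow> \<tau> r [] = c \<circ> h"
    "\<And>r. r \<in> verts G \<Longrightarrow> wins_from G m (\<tau> r) r"
    by metis
  define \<sigma> where "\<sigma> xs = (case xs of [] \<Rightarrow> c \<circ> h | x # ys \<Rightarrow> \<tau> x xs)" for xs
  have pos: "cop_position \<sigma> \<rho> n = cop_position (\<tau> (\<rho> 0)) \<rho> n" if "\<rho> 0 \<in> verts G" for \<rho> n
  proof (cases n)
    case 0
    then show ?thesis using \<tau>(1)[OF that] by (simp add: cop_position_def \<sigma>_def)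
  next
    case (Suc n')
    then show ?thesis by (simp add: cop_position_def \<sigma>_def map_upt_Suc del: upt_Suc)
  qed
  have "cop_strategy G m \<sigma>"
    unfolding cop_strategy_def
  proof (intro conjI allI impI)
    fix i assume "i < m"
    then show "\<sigma> [] i \<in> verts G" using c h by (auto simp: \<sigma>_def)
  next
    fix \<rho> n i assume "robber_play G \<rho>" "i < m"
    then show "game_move G (cop_position \<sigma> \<rho> n i) (cop_position \<sigma> \<rho> (Suc n) i)"
      using \<tau>(2)[of "\<rho> 0"] by (simp add: pos wins_from_def robber_play_def)
  qed
  moreover have "captures m \<sigma> \<rho>" if "robber_play G \<rho>" for \<rho>
    using \<tau>(2)[of "\<rho> 0"] that by (simp add: captures_def pos wins_from_def robber_play_def)
  ultimately show ?thesis unfolding cops_can_win_def by blast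
qed

section \<open>Playing against a clique cover\<close>

text \<open>\<open>\<kappa>\<close> names the clique of each vertex. Since every label below
  \<open>k\<close> is used, each cop finds a post in its own clique.\<close>

locale clique_cover = graph G for G :: "('a, 'b) pre_digraph" +
  fixes \<kappa> :: "'a \<Rightarrow> nat" and k :: nat
  assumes class_less: "v \<in> verts G \<Longrightarrow> \<kappa> v < k"
    and class_adj: "u \<in> verts G \<Longrightarrow> v \<in> verts G \<Longrightarrow> \<kappa> u = \<kappa> v \<Longrightarrow> u \<noteq> v \<Longrightarrow> u \<rightarrow>\<^bsub>G\<^esub> v"
    and class_nonempty: "i < k \<Longrightarrow> \<exists>v\<in>verts G. \<kappa> v = i"
begin

lemma same_class_move:
  "u \<in> verts G \<Longrightarrow> v \<in> verts G \<Longrightarrow> \<kappa> u = \<kappa> v \<Longrightarrow> game_move G u v"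
  using class_adj by (auto simp: game_move_def)

lemma game_move_in_verts: "u \<in> verts G \<Longrightarrow> game_move G u v \<Longrightarrow> v \<in> verts G"
  using adj_in_verts by (auto simp: game_move_def)

definition cops_outside :: "nat \<Rightarrow> (nat \<Rightarrow> 'a) \<Rightarrow> bool" where
  "cops_outside d c \<longleftrightarrow> (\<forall>i<k. i \<noteq> d \<longrightarrow> c i \<in> verts G \<and> \<kappa> (c i) = i)"

text \<open>A robber starting outside clique \<open>d\<close> is in reach of the guard of his
  clique, and one adjacent to a cop is caught at once; only hidden starts in \<open>d\<close> need
  play.\<close>

lemma cops_outside_win:
  assumes "d < k" "cops_outside d c"
    and "\<And>r. r \<in> verts G \<Longrightarrow> \<kappa> r = d \<Longrightarrow> \<forall>i<k. i \<noteq> d \<longrightarrow> \<not> c i \<rightarrow>\<^bsub>G\<^esub> r \<Longrightarrow>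
      cop_win G ({..<k} - {d}) c r"
  shows "cops_can_win G (k - 1)"
proof (rule cops_can_winI[of G "{..<k} - {d}" _ c])
  fix r assume r: "r \<in> verts G"
  show "cop_win G ({..<k} - {d}) c r"
  proof (cases "\<kappa> r = d \<and> (\<forall>i<k. i \<noteq> d \<longrightarrow> \<not> c i \<rightarrow>\<^bsub>G\<^esub> r)")
    case True
    then show ?thesis using assms(3) r by blast
  next
    case False
    then obtain i where "i < k" "i \<noteq> d" "game_move G (c i) r"
    proof (cases "\<kappa> r = d")
      case True
      then show ?thesis using False that by (auto simp: game_move_def)
    next
      case neq: False
      show ?thesis
        by (rule that[of "\<kappa> r"])
          (use neq r class_less assms(2) in \<open>auto simp: cops_outside_def intro: same_class_move\<close>)
    qed
    then show ?thesis by (intro cop_win.capture[of i]) auto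
  qed
qed (use assms wf_digraph in \<open>auto simp: cops_outside_def\<close>)

text \<open>
  The robber is shut in the clique \<open>d\<close> by the cops other than \<open>b\<close>, so cop \<open>b\<close> has time to walk there.
\<close>

lemma unlinked_classes_win:
  assumes conn: "connected G" and d: "d < k" and b: "b < k" "b \<noteq> d"
    and unlinked: "\<And>u v. u \<rightarrow>\<^bsub>G\<^esub> v \<Longrightarrow> \<kappa> u = d \<Longrightarrow> \<kappa> v = b \<Longrightarrow> False"
  shows "cops_can_win G (k - 1)"
proof -
  obtain s where s: "\<And>i. i < k \<Longrightarrow> s i \<in> verts G \<and> \<kappa> (s i) = i"
    using class_nonempty by metis
  \<comment> \<open>Induction along the walk of cop \<open>b\<close>. A robber leaving
    \<open>d\<close> enters a clique other than \<open>b\<close>, whose guard is still at its post;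
    at \<open>s d\<close> cop \<open>b\<close> reaches all of \<open>d\<close>.\<close>
  have trapped: "cop_win G ({..<k} - {d}) (s(b := x)) r"
    if "x \<rightarrow>\<^sup>*\<^bsub>G\<^esub> s d" "r \<in> verts G" "\<kappa> r = d" for x r
    using that
  proof (induction x arbitrary: r rule: converse_reachable_induct)
    case base
    then show ?case
      by (intro cop_win.capture[of b]) (use b d s in \<open>auto intro: same_class_move\<close>)
  next
    case (step x y)
    show ?case
    proof (rule cop_win.move[of _ _ _ "s(b := y)"])
      fix i assume "i \<in> {..<k} - {d}"
      then show "game_move G ((s(b := x)) i) ((s(b := y)) i)"
        using step(1) by (auto simp: game_move_def)
    next
      fix r' assume r': "game_move G r r'"
      have r'V: "r' \<in> verts G" using game_move_in_verts[OF step.prems(1) r'] .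
      have "\<kappa> r' \<noteq> b" using r' unlinked step.prems(2) b by (auto simp: game_move_def)
      show "cop_win G ({..<k} - {d}) (s(b := y)) r'"
      proof (cases "\<kappa> r' = d")
        case True
        then show ?thesis using step.IH r'V by blast
      next
        case False
        show ?thesis
          by (rule cop_win.capture[of "\<kappa> r'"])
            (use False \<open>\<kappa> r' \<noteq> b\<close> r'V class_less s in \<open>auto intro: same_class_move\<close>)
      qed
    qed
  qed
  have "s b \<rightarrow>\<^sup>*\<^bsub>G\<^esub> s d"
    using conn s b d reachable_mk_symmetric_eq[OF sym_arcs]
    by (auto simp: connected_def strongly_connected_def)
  then show ?thesis
    using trapped[of "s b"] s d by (intro cops_outside_win[of d s]) (auto simp: cops_outside_def)
qed

text \<open>Closing pattern of the endgames below: after one move of the cops, every reply of the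
  robber is in reach of a cop.\<close>

lemma final_move_win:
  assumes "r \<in> verts G" and "\<And>i. i \<in> I \<Longrightarrow> game_move G (c i) (c' i)"
    and "\<And>r'. r' \<in> verts G \<Longrightarrow> game_move G r r' \<Longrightarrow> \<exists>i\<in>I. game_move G (c' i) r'"
  shows "cop_win G I c r"
  using assms(2)
proof (rule cop_win.move)
  fix r' assume "game_move G r r'"
  then show "cop_win G I c' r'"
    using assms(3)[of r'] game_move_in_verts[OF assms(1)] cop_win.capture by metis
qed

text \<open>
  Cop \<open>a\<close> threatens to enter the robber's clique \<open>d\<close>; the robber then has to reach a neighbour \<open>q\<close> in
  clique \<open>a\<close> out of sight of \<open>y\<close> and \<open>y'\<close>. The cops occupy \<open>q\<close>, \<open>p\<close> and \<open>z\<close> instead, which leaves the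
  robber at most an escape to a vertex \<open>r'\<close> in clique \<open>b\<close> or \<open>c\<close>, closing an induced 5-cycle
  \<open>r r' y p q\<close> or \<open>r r' y' p q\<close>.
\<close>

lemma transversal_path_win:
  assumes perfect: "perfect_graph G"
    and linked: "\<And>i j. i < k \<Longrightarrow> j < k \<Longrightarrow> i \<noteq> j \<Longrightarrow> \<exists>u v. u \<rightarrow>\<^bsub>G\<^esub> v \<and> \<kappa> u = i \<and> \<kappa> v = j"
    and path: "p \<rightarrow>\<^bsub>G\<^esub> y" "p \<rightarrow>\<^bsub>G\<^esub> y'" "y' \<rightarrow>\<^bsub>G\<^esub> z"
    and cls: "\<kappa> p = a" "\<kappa> y = b" "\<kappa> y' = c" "\<kappa> z = d" and distinct: "distinct [a, b, c, d]"
  shows "cops_can_win G (k - 1)"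
proof -
  have V: "p \<in> verts G" "y \<in> verts G" "y' \<in> verts G" "z \<in> verts G"
    using path adj_in_verts by blast+
  then have less: "a < k" "b < k" "c < k" "d < k" using cls class_less by blast+
  obtain s where s: "\<And>i. i < k \<Longrightarrow> s i \<in> verts G \<and> \<kappa> (s i) = i"
    using class_nonempty by metis
  \<comment> \<open>Cop \<open>a\<close> needs an edge into \<open>d\<close>. It starts at
    \<open>p\<close> if \<open>p\<close> has one; otherwise \<open>p\<close> sees nothing in
    \<open>d\<close>. Either way a robber in \<open>d\<close> hidden from \<open>p0\<close> is not
    adjacent to \<open>p\<close>.\<close>
  obtain p0 z0 where p0: "p0 \<rightarrow>\<^bsub>G\<^esub> z0" "\<kappa> p0 = a" "\<kappa> z0 = d"
    and p0_eq: "p0 = p \<or> (\<forall>v. p \<rightarrow>\<^bsub>G\<^esub> v \<longrightarrow> \<kappa> v \<noteq> d)"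
  proof (cases "\<exists>v. p \<rightarrow>\<^bsub>G\<^esub> v \<and> \<kappa> v = d")
    case True
    then show ?thesis using that cls by blast
  next
    case False
    then show ?thesis using that linked[of a d] less distinct by auto
  qed
  have V0: "p0 \<in> verts G" "z0 \<in> verts G" using p0(1) adj_in_verts by blast+
  define e where "e = s(a := p0, b := y, c := y')"
  have e: "e a = p0" "e b = y" "e c = y'" using distinct by (auto simp: e_def)
  have e_other: "e i = s i" if "i \<notin> {a, b, c}" for i using that by (auto simp: e_def)
  have e_cls: "e i \<in> verts G" "\<kappa> (e i) = i" if "i < k" for i
    using that s V V0 cls p0 by (auto simp: e_def)
  show ?thesis
  proof (rule cops_outside_win[OF less(4), of e])
    show "cops_outside d e" using e_cls by (auto simp: cops_outside_def)
  next
    fix r assume r: "r \<in> verts G" "\<kappa> r = d" and hidden: "\<forall>i<k. i \<noteq> d \<longrightarrow> \<not> e i \<rightarrow>\<^bsub>G\<^esub> r"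
    have ry: "\<not> y \<rightarrow>\<^bsub>G\<^esub> r" "\<not> y' \<rightarrow>\<^bsub>G\<^esub> r" "\<not> p0 \<rightarrow>\<^bsub>G\<^esub> r"
      using hidden e less distinct by auto
    then have rp: "\<not> p \<rightarrow>\<^bsub>G\<^esub> r" using p0_eq r by blast
    show "cop_win G ({..<k} - {d}) e r"
    proof (cases "\<forall>q\<in>verts G. \<kappa> q = a \<longrightarrow> r \<rightarrow>\<^bsub>G\<^esub> q \<longrightarrow> y \<rightarrow>\<^bsub>G\<^esub> q \<or> y' \<rightarrow>\<^bsub>G\<^esub> q")
      case True
      show ?thesis
      proof (rule final_move_win[OF r(1), of _ _ "e(a := z0)"])
        fix i show "game_move G (e i) ((e(a := z0)) i)"
          using p0(1) e(1) by (auto simp: game_move_def)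
      next
        fix r' assume r': "r' \<in> verts G" "game_move G r r'"
        consider "\<kappa> r' = d" | "\<kappa> r' = a" | "\<kappa> r' \<noteq> d" "\<kappa> r' \<noteq> a" by blast
        then show "\<exists>i\<in>{..<k} - {d}. game_move G ((e(a := z0)) i) r'"
        proof cases
          case 1
          then have "game_move G z0 r'" using same_class_move r' V0 p0 by simp
          then show ?thesis using less distinct by (intro bexI[of _ a]) auto
        next
          case 2
          then have "r \<rightarrow>\<^bsub>G\<^esub> r'" using r' r distinct by (auto simp: game_move_def)
          then have "game_move G (e b) r' \<or> game_move G (e c) r'"
            using True r' 2 e by (auto simp: game_move_def)
          then show ?thesis using less distinct by fastforce
        next
          case 3
          then have "game_move G (e (\<kappa> r')) r'"
            using e_cls class_less r' same_class_move by simp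
          then show ?thesis using 3 r' class_less by (intro bexI[of _ "\<kappa> r'"]) auto
        qed
      qed
    next
      case False
      then obtain q where q: "q \<in> verts G" "\<kappa> q = a" "r \<rightarrow>\<^bsub>G\<^esub> q" "\<not> y \<rightarrow>\<^bsub>G\<^esub> q" "\<not> y' \<rightarrow>\<^bsub>G\<^esub> q"
        by blast
      have "q \<noteq> p" using q(3) rp adj_sym by blast
      then have pq: "p \<rightarrow>\<^bsub>G\<^esub> q" using class_adj[of p q] V q cls by auto
      \<comment> \<open>Cop \<open>a\<close> stays in its clique at \<open>q\<close>, cop
        \<open>b\<close> steps from \<open>y\<close> to \<open>p\<close>, and cop \<open>c\<close>
        steps from \<open>y'\<close> to \<open>z\<close> to cover \<open>d\<close>. Only cliques
        \<open>b\<close> and \<open>c\<close> lose their guards.\<close>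
      define e' where "e' = e(a := q, b := p, c := z)"
      have e': "e' a = q" "e' b = p" "e' c = z" using distinct by (auto simp: e'_def)
      have e'_other: "e' i = e i" if "i \<notin> {a, b, c}" for i using that by (auto simp: e'_def)
      show ?thesis
      proof (rule final_move_win[OF r(1), of _ _ e'])
        fix i
        have "game_move G p0 q" using same_class_move V0 q p0 by simp
        then show "game_move G (e i) (e' i)"
          using e e' e'_other[of i] path adj_sym[OF path(1)] by (cases "i \<in> {a, b, c}") (auto simp: game_move_def)
      next
        fix r' assume r': "r' \<in> verts G" "game_move G r r'"
        have pentagon: "p \<rightarrow>\<^bsub>G\<^esub> r' \<or> q \<rightarrow>\<^bsub>G\<^esub> r'"
          if x: "p \<rightarrow>\<^bsub>G\<^esub> x" "\<not> x \<rightarrow>\<^bsub>G\<^esub> r" "\<not> x \<rightarrow>\<^bsub>G\<^esub> q" "\<kappa> r' = \<kappa> x" "\<kappa> x \<noteq> d" for x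
        proof (rule ccontr)
          assume neg: "\<not> ?thesis"
          have rr': "r \<rightarrow>\<^bsub>G\<^esub> r'" using r' r x by (auto simp: game_move_def)
          \<comment> \<open>\<open>r'\<close> and \<open>x\<close> differ because \<open>r\<close>
            is adjacent to \<open>r'\<close> but not to \<open>x\<close>; being in one clique, they
            are adjacent.\<close>
          have "r' \<rightarrow>\<^bsub>G\<^esub> x"
            using class_adj[of r' x] r' x rr' adj_sym adj_in_verts by blast
          then show False
            using perfect_no_induced_C5[OF perfect, of r r' x p q] rr' x q pq neg rp adj_sym by blast
        qed
        consider "\<kappa> r' = a" | "\<kappa> r' = b" | "\<kappa> r' = c" | "\<kappa> r' = d" | "\<kappa> r' \<notin> {a, b, c, d}" by blast
        then have "\<exists>i<k. i \<noteq> d \<and> game_move G (e' i) r'"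
        proof cases
          case 1
          then have "game_move G (e' a) r'" using same_class_move r' q e' by simp
          then show ?thesis using less distinct by auto
        next
          case 2
          then have "game_move G (e' b) r' \<or> game_move G (e' a) r'"
            using pentagon[of y] path ry q cls distinct e' by (auto simp: game_move_def)
          then show ?thesis using less distinct by auto
        next
          case 3
          then have "game_move G (e' b) r' \<or> game_move G (e' a) r'"
            using pentagon[of y'] path ry q cls distinct e' by (auto simp: game_move_def)
          then show ?thesis using less distinct by auto
        next
          case 4
          then have "game_move G (e' c) r'" using same_class_move r' V cls e' by simp
          then show ?thesis using less distinct by auto
        next
          case 5
          then have "game_move G (e' (\<kappa> r')) r'"
            using e'_other e_cls class_less r' same_class_move by simp
          then show ?thesis using 5 class_less r' by blast
        qed
        then show "\<exists>i\<in>{..<k} - {d}. game_move G (e' i) r'" by blast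
      qed
    qed
  qed
qed

text \<open>
  Cop \<open>a\<close> drives the robber from clique \<open>d\<close> into clique \<open>a\<close>. There he has no neighbour in clique \<open>b\<close>, or
  else a transversal path would arise, so he cannot escape when cop \<open>b\<close> enters clique \<open>a\<close> as well.
\<close>

lemma no_transversal_path_win:
  assumes linked: "\<And>i j. i < k \<Longrightarrow> j < k \<Longrightarrow> i \<noteq> j \<Longrightarrow> \<exists>u v. u \<rightarrow>\<^bsub>G\<^esub> v \<and> \<kappa> u = i \<and> \<kappa> v = j"
    and no_path: "\<And>p y y' z. p \<rightarrow>\<^bsub>G\<^esub> y \<Longrightarrow> p \<rightarrow>\<^bsub>G\<^esub> y' \<Longrightarrow> y' \<rightarrow>\<^bsub>G\<^esub> z \<Longrightarrow>
      distinct [\<kappa> p, \<kappa> y, \<kappa> y', \<kappa> z] \<Longrightarrow> False"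
    and less: "a < k" "b < k" "c < k" "d < k" and distinct: "distinct [a, b, c, d]"
  shows "cops_can_win G (k - 1)"
proof -
  \<comment> \<open>Each guard's post \<open>s i\<close> is chosen with an edge to some
    \<open>t i\<close> in \<open>d\<close>, so every cop can enter \<open>d\<close> in one
    move.\<close>
  have "\<forall>i. \<exists>u v. i < k \<longrightarrow> i \<noteq> d \<longrightarrow> u \<rightarrow>\<^bsub>G\<^esub> v \<and> \<kappa> u = i \<and> \<kappa> v = d"
    using linked less by blast
  then obtain s t where st: "\<And>i. i < k \<Longrightarrow> i \<noteq> d \<Longrightarrow> s i \<rightarrow>\<^bsub>G\<^esub> t i \<and> \<kappa> (s i) = i \<and> \<kappa> (t i) = d"
    by metis
  have stV: "s i \<in> verts G" "t i \<in> verts G" if "i < k" "i \<noteq> d" for i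
    using st[OF that] adj_in_verts by blast+
  have s_dom: "game_move G (s (\<kappa> v)) v" if "v \<in> verts G" "\<kappa> v \<noteq> d" for v
    using same_class_move[of "s (\<kappa> v)" v] that class_less stV st by simp
  have t_dom: "game_move G (t i) v" if "i < k" "i \<noteq> d" "v \<in> verts G" "\<kappa> v = d" for i v
    using same_class_move[of "t i" v] that stV st by simp
  obtain u v where uv: "u \<rightarrow>\<^bsub>G\<^esub> v" "\<kappa> u = b" "\<kappa> v = a"
    using linked[of b a] less distinct by auto
  have uvV: "u \<in> verts G" "v \<in> verts G" using uv adj_in_verts by blast+
  show ?thesis
  proof (rule cops_outside_win[OF less(4), of s])
    show "cops_outside d s" using st stV by (auto simp: cops_outside_def)
  next
    fix r assume r: "r \<in> verts G" "\<kappa> r = d"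
    show "cop_win G ({..<k} - {d}) s r"
    proof (cases "\<exists>i<k. i \<noteq> d \<and> (\<forall>w. r \<rightarrow>\<^bsub>G\<^esub> w \<longrightarrow> \<kappa> w \<noteq> i)")
      case True
      then obtain i where i: "i < k" "i \<noteq> d" "\<And>w. r \<rightarrow>\<^bsub>G\<^esub> w \<Longrightarrow> \<kappa> w \<noteq> i" by blast
      show ?thesis
      proof (rule final_move_win[OF r(1), of _ _ "s(i := t i)"])
        fix j show "game_move G (s j) ((s(i := t i)) j)"
          using st[OF i(1,2)] by (auto simp: game_move_def)
      next
        fix r' assume r': "r' \<in> verts G" "game_move G r r'"
        have "\<kappa> r' \<noteq> i" using r' r i by (auto simp: game_move_def)
        then show "\<exists>j\<in>{..<k} - {d}. game_move G ((s(i := t i)) j) r'"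
          using t_dom[OF i(1,2) r'(1)] s_dom[OF r'(1)] i class_less[OF r'(1)]
          by (cases "\<kappa> r' = d") (auto intro: bexI[of _ i] bexI[of _ "\<kappa> r'"])
      qed
    next
      case False
      \<comment> \<open>Cop \<open>a\<close> enters \<open>d\<close> at \<open>t a\<close>, which
        leaves only clique \<open>a\<close> open; cop \<open>b\<close> waits at \<open>u\<close>,
        from where it can step to \<open>v\<close> in clique \<open>a\<close>.\<close>
      define s1 where "s1 = s(a := t a, b := u)"
      define s2 where "s2 = s1(b := v)"
      have s1: "s1 a = t a" "s1 b = u" and s2: "s2 a = t a" "s2 b = v"
        using distinct by (auto simp: s1_def s2_def)
      have s1_other: "s1 i = s i" and s2_other: "s2 i = s i" if "i \<noteq> a" "i \<noteq> b" for i
        using that by (auto simp: s1_def s2_def)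
      have ta: "game_move G (t a) w" if "w \<in> verts G" "\<kappa> w = d" for w
        using t_dom[of a w] that less distinct by auto
      show ?thesis
      proof (rule cop_win.move[of _ _ _ s1])
        fix i
        have "game_move G (s b) u" using same_class_move[of "s b" u] st stV uv uvV less distinct by auto
        moreover have "s a \<rightarrow>\<^bsub>G\<^esub> t a" using st[of a] less distinct by auto
        ultimately show "game_move G (s i) (s1 i)" by (auto simp: s1_def game_move_def)
      next
        fix r' assume gm: "game_move G r r'"
        have r'V: "r' \<in> verts G" using game_move_in_verts[OF r(1) gm] .
        consider "\<kappa> r' = d" | "\<kappa> r' = b" | "\<kappa> r' \<notin> {a, b, d}" | "\<kappa> r' = a" by blast
        then show "cop_win G ({..<k} - {d}) s1 r'"
        proof cases
          case 1
          then show ?thesis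
            using ta[OF r'V] s1 less distinct by (intro cop_win.capture[of a]) auto
        next
          case 2
          then show ?thesis
            using same_class_move[of u r'] uv uvV r'V s1 less distinct
            by (intro cop_win.capture[of b]) auto
        next
          case 3
          then show ?thesis
            using s_dom[OF r'V] s1_other[of "\<kappa> r'"] class_less[OF r'V]
            by (intro cop_win.capture[of "\<kappa> r'"]) auto
        next
          case 4
          then have rr': "r \<rightarrow>\<^bsub>G\<^esub> r'" using gm r distinct by (auto simp: game_move_def)
          obtain x where x: "r \<rightarrow>\<^bsub>G\<^esub> x" "\<kappa> x = c" using False less distinct by auto
          \<comment> \<open>The path \<open>x\<close>, \<open>r\<close>, \<open>r'\<close>,
            \<open>w\<close> would visit the cliques \<open>c\<close>, \<open>d\<close>,
            \<open>a\<close>, \<open>b\<close> and contradict \<open>no_path\<close>.\<close>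
          have no_b: "\<kappa> w \<noteq> b" if "r' \<rightarrow>\<^bsub>G\<^esub> w" for w
            using no_path[OF x(1) rr' that] x r 4 distinct by auto
          show ?thesis
          proof (rule final_move_win[OF r'V, of _ _ s2])
            fix i show "game_move G (s1 i) (s2 i)"
              using s1 uv by (auto simp: s2_def game_move_def)
          next
            fix r'' assume r'': "r'' \<in> verts G" "game_move G r' r''"
            have "\<kappa> r'' \<noteq> b" using r'' no_b 4 distinct by (auto simp: game_move_def)
            then consider "\<kappa> r'' = d" | "\<kappa> r'' = a" | "\<kappa> r'' \<notin> {a, b, d}" by blast
            then have "\<exists>i<k. i \<noteq> d \<and> game_move G (s2 i) r''"
            proof cases
              case 1
              then show ?thesis using ta[OF r''(1)] s2 less distinct by (intro exI[of _ a]) auto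
            next
              case 2
              then show ?thesis
                using same_class_move[of v r''] uv uvV r'' s2 less distinct
                by (intro exI[of _ b]) auto
            next
              case 3
              then show ?thesis
                using s_dom[OF r''(1)] s2_other[of "\<kappa> r''"] class_less[OF r''(1)] by auto
            qed
            then show "\<exists>i\<in>{..<k} - {d}. game_move G (s2 i) r''" by blast
          qed
        qed
      qed
    qed
  qed
qed

lemma perfect_cops_can_win:
  assumes "connected G" "perfect_graph G" "k \<ge> 4"
  shows "cops_can_win G (k - 1)"
proof (cases "\<forall>i<k. \<forall>j<k. i \<noteq> j \<longrightarrow> (\<exists>u v. u \<rightarrow>\<^bsub>G\<^esub> v \<and> \<kappa> u = i \<and> \<kappa> v = j)")
  case False
  then show ?thesis using unlinked_classes_win[OF assms(1)] by metis
next
  case True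
  then have linked: "\<exists>u v. u \<rightarrow>\<^bsub>G\<^esub> v \<and> \<kappa> u = i \<and> \<kappa> v = j" if "i < k" "j < k" "i \<noteq> j" for i j
    using that by blast
  show ?thesis
  proof (cases "\<exists>p y y' z. p \<rightarrow>\<^bsub>G\<^esub> y \<and> p \<rightarrow>\<^bsub>G\<^esub> y' \<and> y' \<rightarrow>\<^bsub>G\<^esub> z \<and> distinct [\<kappa> p, \<kappa> y, \<kappa> y', \<kappa> z]")
    case True
    then show ?thesis using transversal_path_win[OF assms(2) linked] by blast
  next
    case False
    show ?thesis
    proof (rule no_transversal_path_win[OF linked, of 0 1 2 3])
      fix p y y' z
      assume "p \<rightarrow>\<^bsub>G\<^esub> y" "p \<rightarrow>\<^bsub>G\<^esub> y'" "y' \<rightarrow>\<^bsub>G\<^esub> z" "distinct [\<kappa> p, \<kappa> y, \<kappa> y', \<kappa> z]"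
      then show False using False by blast
    qed (use assms(3) in auto)
  qed
qed

end

theorem theorem1p3:
  fixes G :: "('a, 'b) pre_digraph"
  assumes "Digraph.graph G"
    and "Digraph_Component.connected G"
    and "perfect_graph G"
    and "independence_number G \<ge> 4"
  shows "cop_number G < independence_number G"
proof -
  interpret graph G by (rule assms(1))
  let ?k = "independence_number G"
  let ?A = "{A. independent_set G A}"
  have fin: "finite ?A"
    by (rule finite_subset[of _ "Pow (verts G)"]) (auto simp: independent_set_def)
  have bound: "card A \<le> ?k" if "independent_set G A" for A
    unfolding independence_number_def using fin that by (intro Max_ge) auto
  have "independent_set G {}" by (simp add: independent_set_def)
  then have "?k \<in> card ` ?A"
    unfolding independence_number_def using fin by (intro Max_in) auto
  then obtain A where A: "independent_set G A" "card A = ?k" by auto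
  obtain \<kappa> where \<kappa>: "\<forall>v\<in>verts G. \<kappa> v < ?k"
    "\<forall>u\<in>verts G. \<forall>v\<in>verts G. \<kappa> u = \<kappa> v \<longrightarrow> u \<noteq> v \<longrightarrow> u \<rightarrow>\<^bsub>G\<^esub> v"
    using perfect_clique_cover[OF assms(3) subset_refl] bound by blast
  have AV: "A \<subseteq> verts G" using A by (simp add: independent_set_def)
  \<comment> \<open>Vertices of an independent set lie in distinct cliques, so a maximum one uses
    all labels; this yields \<open>class_nonempty\<close>.\<close>
  have "inj_on \<kappa> A"
    using A(1) AV \<kappa>(2) unfolding inj_on_def independent_set_def by blast
  then have "\<kappa> ` A = {..<?k}"
    using A(2) AV \<kappa>(1) by (intro card_subset_eq) (auto simp: card_image)
  then have nonempty: "\<exists>v\<in>verts G. \<kappa> v = i" if "i < ?k" for i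
    using that AV by (metis imageE lessThan_iff subsetD)
  interpret clique_cover G \<kappa> ?k
    by unfold_locales (use \<kappa> nonempty in auto)
  have "cops_can_win G (?k - 1)" using perfect_cops_can_win assms by blast
  then have "cop_number G \<le> ?k - 1" unfolding cop_number_def by (rule Least_le)
  then show ?thesis using assms(4) by linarith
qed

end
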